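(* For every NautiLOD expression $ne$ there exists an LDQL query $q(?x)$, with $?x$ a free variable, that is equivalent to $ne$; that is, for every Web of Linked Data $W=\langle D,adoc\rangle$ and all URIs $u,u'$ with $u\in\mathrm{dom}(adoc)$, $$u'\in[\![ne]\!]^u_W\quad\Longleftrightarrow\quad\{?x\mapsto u'\}\in[\![q(?x)]\!]^{\{u\}}_W .$$
   Context: **Data model.** $\mathcal U$ (URIs), $\mathcal B$ (blank nodes), $\mathcal L$ (literals), $\mathcal V$ (variables, written $?v,?x,\dots$) and $\mathcal D$ (documents) are pairwise disjoint infinite sets. An RDF triple is an element of $\mathcal T=(\mathcal U\cup\mathcal B)\times\mathcal U\times(\mathcal U\cup\mathcal B\cup\mathcal L)$; $\mathrm{uris}(t)$ is the set of URIs in the triple $t$. Each document $d$ carries a finite set of triples $\mathrm{data}(d)\subseteq\mathcal T$, distinct documents using disjoint sets of blank nodes. A Web of Linked Data is $W=\langle D,adoc\rangle$ with $D\subseteq\mathcal D$ finite and $adoc:\mathcal U\to D$ a partial surjective function with domain $\mathrm{dom}(adoc)$. When quantifying over all Webs, the assignment $\mathrm{data}$ also varies over all possibilities. The link graph $\mathcal G_W$ has node set $D$ and edges $\langle d,(t,u),d'\rangle$ for all $d\in D$, $t\in\mathrm{data}(d)$, $u\in\mathrm{uris}(t)\cap\mathrm{dom}(adoc)$, $d'=adoc(u)$. **SPARQL.** A solution mapping $\mu$ is a partial function with finite domain from $\mathcal V$ to $\mathcal U\cup\mathcal B\cup\mathcal L$; $\mu[\alpha]=\mu(\alpha)$ if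 $\alpha\in\mathrm{dom}(\mu)$, else $\mu[\alpha]=\alpha$ (extended componentwise to triples). $\mu,\mu'$ are compatible if they agree on $\mathrm{dom}(\mu)\cap\mathrm{dom}(\mu')$. $\Omega_1\Join\Omega_2=\{\mu_1\cup\mu_2\mid\mu_i\in\Omega_i\text{ compatible}\}$. An RDF dataset $\mathfrak D$ consists of a default graph and finitely or infinitely many named graphs $\langle u,G_u\rangle$ with pairwise distinct names $u\in\mathcal U$. Graph patterns: finite sets $B$ of triple patterns from $(\mathcal U\cup\mathcal L\cup\mathcal V)\times(\mathcal U\cup\mathcal V)\times(\mathcal U\cup\mathcal L\cup\mathcal V)$ (basic graph patterns, possibly the empty one $\{\,\}$; a triple pattern is identified with a singleton), and $(P_1\,\mathsf{AND}\,P_2)$, $(P_1\,\mathsf{UNION}\,P_2)$, $(P_1\,\mathsf{OPT}\,P_2)$, $(P_1\,\mathsf{FILTER}\,R)$, $(\mathsf{GRAPH}\ c\ P_1)$ with $c\in\mathcal U\cup\mathcal V$, $(P_1\,\mathsf{BIND}(e\,\mathsf{AS}\,?v))$ with $e\in\mathcal U\cup\mathcal L\cup\mathcal V$ and $?v$ not occurring in $P_1$. Filter conditions are Boolean combinations of $\mathrm{bound}(?x)$, $?x=c$, $?x=?y$ (atoms with an unbound variable are false). Evaluation $[\![P]\!]^{\mathfrak D}_G$: $[\![B]\!]=\{\mu\mid\mathrm{dom}(\mu)=\mathrm{var}(B),\mu[B]\subseteq G\}$; $\mathsf{AND}$ is $\Join$; $\mathsf{UNION}$ is $\cup$; $\mathsf{OPT}$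 gives $(\Omega_1\Join\Omega_2)\cup\{\mu\in\Omega_1\mid\text{no }\mu'\in\Omega_2\text{ compatible with }\mu\}$; $\mathsf{FILTER}$ selects the mappings satisfying $R$; $[\![\mathsf{GRAPH}\ u\ P_1]\!]^{\mathfrak D}_G=[\![P_1]\!]^{\mathfrak D}_{G_u}$ ($G_u=\emptyset$ if $u$ is not a name in $\mathfrak D$); $[\![\mathsf{GRAPH}\ ?x\ P_1]\!]^{\mathfrak D}_G=\bigcup_{u\text{ name in }\mathfrak D}([\![P_1]\!]^{\mathfrak D}_{G_u}\Join\{\{?x\mapsto u\}\})$; $\mathsf{BIND}$ extends each mapping $\mu$ by $?v\mapsto\mu[e]$ (leaving $\mu$ unchanged if $e$ is an unbound variable). $[\![P]\!]_G$ (without dataset) means evaluation over $G$ in the dataset with default graph $G$ and no named graphs. **LDQL.** A link pattern is a tuple in $(\mathcal U\cup\{\_,+\})\times(\mathcal U\cup\{\_,+\})\times(\mathcal U\cup\mathcal L\cup\{\_,+\})$. An edge with label $(\langle x_1,x_2,x_3\rangle,u)$ matches $\langle y_1,y_2,y_3\rangle$ in the context of URI $u_c$ if (1) some $i$ has $y_i=\_$ and $x_i=u$, and (2) for each $i$: $y_i=+$ and $x_i=u_c$, or $y_i=x_i$, or $y_i=\_$. LDQL queries $q$ and link path expressions (LPEs) $lpe$ are given by $q:=\langle lpe,P\rangle\mid(\mathsf{SEED}\ U\ q)\mid(\mathsf{SEED}\ ?v\ q)\mid(q\,\mathsf{AND}\,q)\mid(q\,\mathsf{UNION}\,q)\mid\pi_Vq$,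 $lpe:=\varepsilon\mid lp\mid lpe/lpe\mid lpe|lpe\mid lpe^*\mid[lpe]\mid\langle ?v,q\rangle$, with $lp$ a link pattern, $P$ a graph pattern, $U$ a finite set of URIs, $V$ a finite set of variables. $\mathrm{dataset}_W(U)$ is the dataset with default graph $\bigcup_{u\in U\cap\mathrm{dom}(adoc)}\mathrm{data}(adoc(u))$ and named graphs $\langle u,\mathrm{data}(adoc(u))\rangle$ for $u\in U\cap\mathrm{dom}(adoc)$. For finite $S\subseteq\mathcal U$: $[\![\langle lpe,P\rangle]\!]^S_W=[\![P]\!]^{\mathfrak D}_G$ with $\mathfrak D=\mathrm{dataset}_W(\bigcup_{u\in S}[\![lpe]\!]^u_W)$ and $G$ its default graph; $[\![(\mathsf{SEED}\ U\ q)]\!]^S_W=[\![q]\!]^U_W$; $[\![(\mathsf{SEED}\ ?v\ q)]\!]^S_W=\bigcup_{u\in\mathcal U}([\![q]\!]^{\{u\}}_W\Join\{\{?v\mapsto u\}\})$; $\mathsf{UNION}$ is $\cup$; $\mathsf{AND}$ is $\Join$; $[\![\pi_Vq]\!]^S_W$ consists of the restrictions of the mappings in $[\![q]\!]^S_W$ to $V$. For $u_c\in\mathrm{dom}(adoc)$: $[\![\varepsilon]\!]^{u_c}_W=\{u_c\}$; $[\![lp]\!]^{u_c}_W$ is the set of URIs $u$ such that some edge $\langle adoc(u_c),(t,u),d'\rangle\in\mathcal G_W$ matches $lp$ in the context of $u_c$; $[\![l_1/l_2]\!]^{u_c}_W=\bigcup_{u'\in[\![l_1]\!]^{u_c}_W}[\![l_2]\!]^{u'}_W$;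 $[\![l_1|l_2]\!]^{u_c}_W$ is the union; $[\![l^*]\!]^{u_c}_W=\{u_c\}\cup[\![l]\!]^{u_c}_W\cup[\![l/l]\!]^{u_c}_W\cup\cdots$; $[\![[l]]\!]^{u_c}_W=\{u_c\}$ if $[\![l]\!]^{u_c}_W\ne\emptyset$, else $\emptyset$; $[\![\langle ?v,q\rangle]\!]^{u_c}_W=\{u\in\mathcal U\mid\mu(?v)=u\text{ for some }\mu\in[\![q]\!]^{\{u_c\}}_W\}$. If $u_c\notin\mathrm{dom}(adoc)$ then $[\![lpe]\!]^{u_c}_W=\emptyset$. Writing $q(?x)$ means that $?x$ is the single free variable of $q$: every solution mapping in every $[\![q]\!]^S_W$ has domain contained in $\{?x\}$. **NautiLOD (without actions).** Expressions: $ne:=p\mid p\text{\textasciicircum}\mid\langle\_\rangle\mid ne/ne\mid ne|ne\mid ne^*\mid ne[(\mathsf{ASK}\ P)]$ with $p\in\mathcal U$ and $P$ a SPARQL graph pattern. For $u\in\mathrm{dom}(adoc)$: - $[\![p]\!]^u_W=\{u'\mid\langle u,p,u'\rangle\in\mathrm{data}(adoc(u))\}$; - $[\![p\text{\textasciicircum}]\!]^u_W=\{u'\mid\langle u',p,u\rangle\in\mathrm{data}(adoc(u))\}$; - $[\![\langle\_\rangle]\!]^u_W=\{u'\mid\langle u,p,u'\rangle\in\mathrm{data}(adoc(u))\text{ for some }p\in\mathcal U\}$; - $[\![ne_1/ne_2]\!]^u_W=\{u''\mid u''\in[\![ne_2]\!]^{u'}_W\text{ for some }u'\in[\![ne_1]\!]^u_W\text{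 with }u'\in\mathrm{dom}(adoc)\}$; - $[\![ne_1|ne_2]\!]^u_W=[\![ne_1]\!]^u_W\cup[\![ne_2]\!]^u_W$; - $[\![ne^*]\!]^u_W=\{u\}\cup[\![ne]\!]^u_W\cup[\![ne/ne]\!]^u_W\cup\cdots$; - $[\![ne[(\mathsf{ASK}\ P)]]\!]^u_W=\{u'\in[\![ne]\!]^u_W\mid u'\in\mathrm{dom}(adoc),\ [\![P]\!]_{\mathrm{data}(adoc(u'))}\ne\emptyset\}$. *)

theory Defs
  imports "HOL-Library.FSet" "HOL-Library.Infinite_Typeclass"
begin

section \<open>RDF and Webs of Linked Data\<close>

text \<open>
  The disjoint infinite sets of URIs, blank nodes, literals, variables and documents are the
  types \<open>'u\<close>, \<open>'b\<close>, \<open>'l\<close>, \<open>'v\<close>, \<open>'d\<close>; the infinity assumptions are sort constraints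
  (class \<^class>\<open>infinite\<close>) on the type variables, to be imposed wherever results are stated.
\<close>

datatype ('u, 'b, 'l) rdf_term = URI 'u | Blank 'b | Literal 'l

type_synonym ('u, 'b, 'l) triple =
  "('u, 'b, 'l) rdf_term \<times> ('u, 'b, 'l) rdf_term \<times> ('u, 'b, 'l) rdf_term"

text \<open>
  The type \<open>triple\<close> also contains generalized triples; \<open>rdf_triples\<close> carves out the set
  \<open>(U \<union> B) \<times> U \<times> (U \<union> B \<union> L)\<close>.
\<close>

definition rdf_triples :: "('u, 'b, 'l) triple set" where
  "rdf_triples = (range URI \<union> range Blank) \<times> range URI \<times> UNIV"

definition uris :: "('u, 'b, 'l) triple \<Rightarrow> 'u set" where
  "uris t = (case t of (s, p, o') \<Rightarrow> {u. URI u \<in> {s, p, o'}})"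

definition blanks :: "('u, 'b, 'l) triple \<Rightarrow> 'b set" where
  "blanks t = (case t of (s, p, o') \<Rightarrow> {b. Blank b \<in> {s, p, o'}})"

text \<open>
  The assignment \<open>data\<close> is a component of the Web, so that quantifying over Webs also varies it.
  It is defined, and constrained by \<open>linked_data_web\<close> below, on all documents and not only on
  those of the Web.
\<close>

record ('u, 'b, 'l, 'd) web =
  docs :: "'d set"
  adoc :: "'u \<rightharpoonup> 'd"
  data :: "'d \<Rightarrow> ('u, 'b, 'l) triple set"

definition linked_data_web :: "('u, 'b, 'l, 'd) web \<Rightarrow> bool" where
  "linked_data_web W \<longleftrightarrow>
     finite (docs W) \<and> ran (adoc W) = docs W \<and>
     (\<forall>d. finite (data W d) \<and> data W d \<subseteq> rdf_triples) \<and>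
     (\<forall>d d'. d \<noteq> d' \<longrightarrow> \<Union>(blanks ` data W d) \<inter> \<Union>(blanks ` data W d') = {})"

text \<open>Meaningful only for \<open>u \<in> dom (adoc W)\<close>; all uses below are guarded accordingly.\<close>

definition doc_data :: "('u, 'b, 'l, 'd) web \<Rightarrow> 'u \<Rightarrow> ('u, 'b, 'l) triple set" where
  "doc_data W u = data W (the (adoc W u))"

definition link_graph :: "('u, 'b, 'l, 'd) web \<Rightarrow> ('d \<times> (('u, 'b, 'l) triple \<times> 'u) \<times> 'd) set" where
  "link_graph W = {(d, (t, u), d') | d t u d'.
     d \<in> docs W \<and> t \<in> data W d \<and> u \<in> uris t \<and> adoc W u = Some d'}"


section \<open>SPARQL\<close>

subsection \<open>Syntax\<close>

datatype (slot_consts: 'c, slot_vars: 'v) slot = Const 'c | Var 'v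

type_synonym ('u, 'l, 'v) triple_pattern =
  "('u + 'l, 'v) slot \<times> ('u, 'v) slot \<times> ('u + 'l, 'v) slot"

datatype ('u, 'l, 'v) filter_cond =
    Bound 'v
  | EqConst 'v "'u + 'l"
  | EqVar 'v 'v
  | CNot "('u, 'l, 'v) filter_cond"
  | CAnd "('u, 'l, 'v) filter_cond" "('u, 'l, 'v) filter_cond"
  | COr "('u, 'l, 'v) filter_cond" "('u, 'l, 'v) filter_cond"

datatype ('u, 'l, 'v) graph_pattern =
    BGP "('u, 'l, 'v) triple_pattern fset"
  | AND "('u, 'l, 'v) graph_pattern" "('u, 'l, 'v) graph_pattern"
  | UNION "('u, 'l, 'v) graph_pattern" "('u, 'l, 'v) graph_pattern"
  | OPT "('u, 'l, 'v) graph_pattern" "('u, 'l, 'v) graph_pattern"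
  | FILTER "('u, 'l, 'v) graph_pattern" "('u, 'l, 'v) filter_cond"
  | GRAPH "('u, 'v) slot" "('u, 'l, 'v) graph_pattern"
  | BIND "('u, 'l, 'v) graph_pattern" "('u + 'l, 'v) slot" 'v

definition tp_vars :: "('u, 'l, 'v) triple_pattern \<Rightarrow> 'v set" where
  "tp_vars tp = (case tp of (s, p, o') \<Rightarrow> slot_vars s \<union> slot_vars p \<union> slot_vars o')"

definition bgp_vars :: "('u, 'l, 'v) triple_pattern fset \<Rightarrow> 'v set" where
  "bgp_vars B = \<Union>(tp_vars ` fset B)"

primrec cond_vars :: "('u, 'l, 'v) filter_cond \<Rightarrow> 'v set" where
  "cond_vars (Bound x) = {x}"
| "cond_vars (EqConst x c) = {x}"
| "cond_vars (EqVar x y) = {x, y}"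
| "cond_vars (CNot R) = cond_vars R"
| "cond_vars (CAnd R1 R2) = cond_vars R1 \<union> cond_vars R2"
| "cond_vars (COr R1 R2) = cond_vars R1 \<union> cond_vars R2"

primrec pattern_vars :: "('u, 'l, 'v) graph_pattern \<Rightarrow> 'v set" where
  "pattern_vars (BGP B) = bgp_vars B"
| "pattern_vars (AND P1 P2) = pattern_vars P1 \<union> pattern_vars P2"
| "pattern_vars (UNION P1 P2) = pattern_vars P1 \<union> pattern_vars P2"
| "pattern_vars (OPT P1 P2) = pattern_vars P1 \<union> pattern_vars P2"
| "pattern_vars (FILTER P R) = pattern_vars P \<union> cond_vars R"
| "pattern_vars (GRAPH c P) = slot_vars c \<union> pattern_vars P"
| "pattern_vars (BIND P e v) = pattern_vars P \<union> slot_vars e \<union> {v}"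

text \<open>The only side condition not enforced by the datatype is the one on the target of \<open>BIND\<close>.\<close>

primrec wf_pattern :: "('u, 'l, 'v) graph_pattern \<Rightarrow> bool" where
  "wf_pattern (BGP B) \<longleftrightarrow> True"
| "wf_pattern (AND P1 P2) \<longleftrightarrow> wf_pattern P1 \<and> wf_pattern P2"
| "wf_pattern (UNION P1 P2) \<longleftrightarrow> wf_pattern P1 \<and> wf_pattern P2"
| "wf_pattern (OPT P1 P2) \<longleftrightarrow> wf_pattern P1 \<and> wf_pattern P2"
| "wf_pattern (FILTER P R) \<longleftrightarrow> wf_pattern P"
| "wf_pattern (GRAPH c P) \<longleftrightarrow> wf_pattern P"
| "wf_pattern (BIND P e v) \<longleftrightarrow> wf_pattern P \<and> v \<notin> pattern_vars P"

subsection \<open>Semantics\<close>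

text \<open>
  Finiteness of the domain is not part of the type of solution mappings: every mapping produced
  by the evaluation functions below has a finite domain.
\<close>

type_synonym ('u, 'b, 'l, 'v) mapping = "'v \<rightharpoonup> ('u, 'b, 'l) rdf_term"

definition compatible :: "('v \<rightharpoonup> 't) \<Rightarrow> ('v \<rightharpoonup> 't) \<Rightarrow> bool" where
  "compatible \<mu> \<mu>' \<longleftrightarrow> (\<forall>x \<in> dom \<mu> \<inter> dom \<mu>'. \<mu> x = \<mu>' x)"

definition join :: "('v \<rightharpoonup> 't) set \<Rightarrow> ('v \<rightharpoonup> 't) set \<Rightarrow> ('v \<rightharpoonup> 't) set" where
  "join \<Omega>1 \<Omega>2 = {\<mu>1 ++ \<mu>2 | \<mu>1 \<mu>2. \<mu>1 \<in> \<Omega>1 \<and> \<mu>2 \<in> \<Omega>2 \<and> compatible \<mu>1 \<mu>2}"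

text \<open>\<open>\<mu>[\<alpha>]\<close>, where \<open>\<alpha>\<close> and the result are terms (\<open>Const\<close>) or variables (\<open>Var\<close>).\<close>

definition subst :: "('v \<rightharpoonup> 't) \<Rightarrow> ('t, 'v) slot \<Rightarrow> ('t, 'v) slot" where
  "subst \<mu> \<alpha> = (case \<alpha> of Const t \<Rightarrow> Const t
     | Var x \<Rightarrow> (case \<mu> x of Some t \<Rightarrow> Const t | None \<Rightarrow> Var x))"

abbreviation const_term :: "'u + 'l \<Rightarrow> ('u, 'b, 'l) rdf_term" where
  "const_term \<equiv> case_sum URI Literal"

definition subst_tp :: "('u, 'b, 'l, 'v) mapping \<Rightarrow> ('u, 'l, 'v) triple_pattern \<Rightarrow>
    (('u, 'b, 'l) rdf_term, 'v) slot \<times> (('u, 'b, 'l) rdf_term, 'v) slot \<times>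
    (('u, 'b, 'l) rdf_term, 'v) slot" where
  "subst_tp \<mu> tp = (case tp of (s, p, o') \<Rightarrow>
     (subst \<mu> (map_slot const_term id s), subst \<mu> (map_slot URI id p),
      subst \<mu> (map_slot const_term id o')))"

definition eval_bgp :: "('u, 'l, 'v) triple_pattern fset \<Rightarrow> ('u, 'b, 'l) triple set \<Rightarrow>
    ('u, 'b, 'l, 'v) mapping set" where
  "eval_bgp B G = {\<mu>. dom \<mu> = bgp_vars B \<and>
     subst_tp \<mu> ` fset B \<subseteq> (\<lambda>(s, p, o'). (Const s, Const p, Const o')) ` G}"

primrec satisfies :: "('u, 'b, 'l, 'v) mapping \<Rightarrow> ('u, 'l, 'v) filter_cond \<Rightarrow> bool" where
  "satisfies \<mu> (Bound x) \<longleftrightarrow> x \<in> dom \<mu>"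
| "satisfies \<mu> (EqConst x c) \<longleftrightarrow> \<mu> x = Some (const_term c)"
| "satisfies \<mu> (EqVar x y) \<longleftrightarrow> x \<in> dom \<mu> \<and> y \<in> dom \<mu> \<and> \<mu> x = \<mu> y"
| "satisfies \<mu> (CNot R) \<longleftrightarrow> \<not> satisfies \<mu> R"
| "satisfies \<mu> (CAnd R1 R2) \<longleftrightarrow> satisfies \<mu> R1 \<and> satisfies \<mu> R2"
| "satisfies \<mu> (COr R1 R2) \<longleftrightarrow> satisfies \<mu> R1 \<or> satisfies \<mu> R2"

definition bind :: "('u + 'l, 'v) slot \<Rightarrow> 'v \<Rightarrow> ('u, 'b, 'l, 'v) mapping \<Rightarrow>
    ('u, 'b, 'l, 'v) mapping" where
  "bind e v \<mu> = (case subst \<mu> (map_slot const_term id e) of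
     Const t \<Rightarrow> \<mu>(v \<mapsto> t) | Var y \<Rightarrow> \<mu>)"

record ('u, 'b, 'l) dataset =
  default_graph :: "('u, 'b, 'l) triple set"
  named_graphs :: "'u \<rightharpoonup> ('u, 'b, 'l) triple set"

primrec eval_pattern :: "('u, 'l, 'v) graph_pattern \<Rightarrow> ('u, 'b, 'l) dataset \<Rightarrow>
    ('u, 'b, 'l) triple set \<Rightarrow> ('u, 'b, 'l, 'v) mapping set" where
  "eval_pattern (BGP B) \<DD> G = eval_bgp B G"
| "eval_pattern (AND P1 P2) \<DD> G = join (eval_pattern P1 \<DD> G) (eval_pattern P2 \<DD> G)"
| "eval_pattern (UNION P1 P2) \<DD> G = eval_pattern P1 \<DD> G \<union> eval_pattern P2 \<DD> G"
| "eval_pattern (OPT P1 P2) \<DD> G =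
     join (eval_pattern P1 \<DD> G) (eval_pattern P2 \<DD> G) \<union>
     {\<mu> \<in> eval_pattern P1 \<DD> G. \<not> (\<exists>\<mu>' \<in> eval_pattern P2 \<DD> G. compatible \<mu> \<mu>')}"
| "eval_pattern (FILTER P R) \<DD> G = {\<mu> \<in> eval_pattern P \<DD> G. satisfies \<mu> R}"
| "eval_pattern (GRAPH c P) \<DD> G = (case c of
       Const u \<Rightarrow> eval_pattern P \<DD> (case named_graphs \<DD> u of Some G' \<Rightarrow> G' | None \<Rightarrow> {})
     | Var x \<Rightarrow> \<Union>u \<in> dom (named_graphs \<DD>).
         join (eval_pattern P \<DD> (the (named_graphs \<DD> u))) {[x \<mapsto> URI u]})"
| "eval_pattern (BIND P e v) \<DD> G = bind e v ` eval_pattern P \<DD> G"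

definition eval_over_graph :: "('u, 'l, 'v) graph_pattern \<Rightarrow> ('u, 'b, 'l) triple set \<Rightarrow>
    ('u, 'b, 'l, 'v) mapping set" where
  "eval_over_graph P G = eval_pattern P \<lparr>default_graph = G, named_graphs = Map.empty\<rparr> G"


section \<open>LDQL\<close>

subsection \<open>Syntax\<close>

text \<open>\<open>Any\<close> is the wildcard \<open>_\<close> and \<open>Ctx\<close> is the context symbol \<open>+\<close>.\<close>

datatype 'c lp_elem = Any | Ctx | Exactly 'c

type_synonym ('u, 'l) link_pattern = "'u lp_elem \<times> 'u lp_elem \<times> ('u + 'l) lp_elem"

datatype ('u, 'l, 'v) ldql =
    Basic "('u, 'l, 'v) lpe" "('u, 'l, 'v) graph_pattern"
  | SeedUris "'u fset" "('u, 'l, 'v) ldql"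
  | SeedVar 'v "('u, 'l, 'v) ldql"
  | QAnd "('u, 'l, 'v) ldql" "('u, 'l, 'v) ldql"
  | QUnion "('u, 'l, 'v) ldql" "('u, 'l, 'v) ldql"
  | Proj "'v fset" "('u, 'l, 'v) ldql"
and ('u, 'l, 'v) lpe =
    Eps
  | Link "('u, 'l) link_pattern"
  | Seq "('u, 'l, 'v) lpe" "('u, 'l, 'v) lpe"
  | Alt "('u, 'l, 'v) lpe" "('u, 'l, 'v) lpe"
  | Star "('u, 'l, 'v) lpe"
  | Test "('u, 'l, 'v) lpe"
  | SubQuery 'v "('u, 'l, 'v) ldql"

primrec wf_ldql :: "('u, 'l, 'v) ldql \<Rightarrow> bool"
    and wf_lpe :: "('u, 'l, 'v) lpe \<Rightarrow> bool" where
  "wf_ldql (Basic l P) \<longleftrightarrow> wf_lpe l \<and> wf_pattern P"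
| "wf_ldql (SeedUris U q) \<longleftrightarrow> wf_ldql q"
| "wf_ldql (SeedVar v q) \<longleftrightarrow> wf_ldql q"
| "wf_ldql (QAnd q1 q2) \<longleftrightarrow> wf_ldql q1 \<and> wf_ldql q2"
| "wf_ldql (QUnion q1 q2) \<longleftrightarrow> wf_ldql q1 \<and> wf_ldql q2"
| "wf_ldql (Proj V q) \<longleftrightarrow> wf_ldql q"
| "wf_lpe Eps \<longleftrightarrow> True"
| "wf_lpe (Link lp) \<longleftrightarrow> True"
| "wf_lpe (Seq l1 l2) \<longleftrightarrow> wf_lpe l1 \<and> wf_lpe l2"
| "wf_lpe (Alt l1 l2) \<longleftrightarrow> wf_lpe l1 \<and> wf_lpe l2"
| "wf_lpe (Star l) \<longleftrightarrow> wf_lpe l"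
| "wf_lpe (Test l) \<longleftrightarrow> wf_lpe l"
| "wf_lpe (SubQuery v q) \<longleftrightarrow> wf_ldql q"

subsection \<open>Semantics\<close>

fun elem_ok :: "'u \<Rightarrow> ('u, 'b, 'l) rdf_term lp_elem \<Rightarrow> ('u, 'b, 'l) rdf_term \<Rightarrow> bool" where
  "elem_ok uc Any x \<longleftrightarrow> True"
| "elem_ok uc Ctx x \<longleftrightarrow> x = URI uc"
| "elem_ok uc (Exactly c) x \<longleftrightarrow> x = c"

definition link_matches :: "('u, 'b, 'l) triple \<times> 'u \<Rightarrow> ('u, 'l) link_pattern \<Rightarrow> 'u \<Rightarrow> bool" where
  "link_matches label lp uc = (case label of ((x1, x2, x3), u) \<Rightarrow> case lp of (y1, y2, y3) \<Rightarrow>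
     (y1 = Any \<and> x1 = URI u \<or> y2 = Any \<and> x2 = URI u \<or> y3 = Any \<and> x3 = URI u) \<and>
     elem_ok uc (map_lp_elem URI y1) x1 \<and>
     elem_ok uc (map_lp_elem URI y2) x2 \<and>
     elem_ok uc (map_lp_elem const_term y3) x3)"

definition web_dataset :: "('u, 'b, 'l, 'd) web \<Rightarrow> 'u set \<Rightarrow> ('u, 'b, 'l) dataset" where
  "web_dataset W U =
     \<lparr>default_graph = (\<Union>u \<in> U \<inter> dom (adoc W). doc_data W u),
      named_graphs = (\<lambda>u. if u \<in> U \<inter> dom (adoc W) then Some (doc_data W u) else None)\<rparr>"

definition lpe_comp :: "('u \<Rightarrow> 'u set) \<Rightarrow> ('u \<Rightarrow> 'u set) \<Rightarrow> 'u \<Rightarrow> 'u set" where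
  "lpe_comp f g u = (\<Union>u' \<in> f u. g u')"

text \<open>
  \<open>powers cmp f n\<close> is the \<open>(n+1)\<close>-fold composition of \<open>f\<close> with itself, so that the meaning of a
  starred expression is \<open>{u} \<union> (\<Union>n. powers cmp f n u)\<close>. Starting from \<open>f\<close> rather than from the
  identity matters for \<open>ne_comp\<close> below, for which the identity is not neutral.
\<close>

primrec powers :: "(('u \<Rightarrow> 'u set) \<Rightarrow> ('u \<Rightarrow> 'u set) \<Rightarrow> 'u \<Rightarrow> 'u set) \<Rightarrow>
    ('u \<Rightarrow> 'u set) \<Rightarrow> nat \<Rightarrow> 'u \<Rightarrow> 'u set" where
  "powers cmp f 0 = f"
| "powers cmp f (Suc n) = cmp (powers cmp f n) f"

text \<open>
  Queries are evaluated with respect to an arbitrary set \<open>S\<close> of seed URIs, although only finite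
  \<open>S\<close> are meant; all seed sets arising in the recursive calls are finite.
\<close>

primrec eval_ldql :: "('u, 'b, 'l, 'd) web \<Rightarrow> ('u, 'l, 'v) ldql \<Rightarrow> 'u set \<Rightarrow>
      ('u, 'b, 'l, 'v) mapping set"
    and eval_lpe :: "('u, 'b, 'l, 'd) web \<Rightarrow> ('u, 'l, 'v) lpe \<Rightarrow> 'u \<Rightarrow> 'u set" where
  "eval_ldql W (Basic l P) = (\<lambda>S.
     let \<DD> = web_dataset W (\<Union>u \<in> S. eval_lpe W l u) in eval_pattern P \<DD> (default_graph \<DD>))"
| "eval_ldql W (SeedUris U q) = (\<lambda>S. eval_ldql W q (fset U))"
| "eval_ldql W (SeedVar v q) = (\<lambda>S. \<Union>u. join (eval_ldql W q {u}) {[v \<mapsto> URI u]})"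
| "eval_ldql W (QAnd q1 q2) = (\<lambda>S. join (eval_ldql W q1 S) (eval_ldql W q2 S))"
| "eval_ldql W (QUnion q1 q2) = (\<lambda>S. eval_ldql W q1 S \<union> eval_ldql W q2 S)"
| "eval_ldql W (Proj V q) = (\<lambda>S. (\<lambda>\<mu>. \<mu> |` fset V) ` eval_ldql W q S)"
| "eval_lpe W Eps = (\<lambda>uc. if uc \<in> dom (adoc W) then {uc} else {})"
| "eval_lpe W (Link lp) = (\<lambda>uc. if uc \<in> dom (adoc W) then
     {u. \<exists>t d'. (the (adoc W uc), (t, u), d') \<in> link_graph W \<and> link_matches (t, u) lp uc} else {})"
| "eval_lpe W (Seq l1 l2) = (\<lambda>uc. if uc \<in> dom (adoc W) then
     lpe_comp (eval_lpe W l1) (eval_lpe W l2) uc else {})"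
| "eval_lpe W (Alt l1 l2) = (\<lambda>uc. if uc \<in> dom (adoc W) then
     eval_lpe W l1 uc \<union> eval_lpe W l2 uc else {})"
| "eval_lpe W (Star l) = (\<lambda>uc. if uc \<in> dom (adoc W) then
     {uc} \<union> (\<Union>n. powers lpe_comp (eval_lpe W l) n uc) else {})"
| "eval_lpe W (Test l) = (\<lambda>uc. if uc \<in> dom (adoc W) then
     (if eval_lpe W l uc \<noteq> {} then {uc} else {}) else {})"
| "eval_lpe W (SubQuery v q) = (\<lambda>uc. if uc \<in> dom (adoc W) then
     {u. \<exists>\<mu> \<in> eval_ldql W q {uc}. \<mu> v = Some (URI u)} else {})"


section \<open>NautiLOD without actions\<close>

datatype ('u, 'l, 'v) nautilod =
    NPred 'u
  | NInv 'u
  | NAny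
  | NSeq "('u, 'l, 'v) nautilod" "('u, 'l, 'v) nautilod"
  | NAlt "('u, 'l, 'v) nautilod" "('u, 'l, 'v) nautilod"
  | NStar "('u, 'l, 'v) nautilod"
  | NAsk "('u, 'l, 'v) nautilod" "('u, 'l, 'v) graph_pattern"

primrec wf_nautilod :: "('u, 'l, 'v) nautilod \<Rightarrow> bool" where
  "wf_nautilod (NPred p) \<longleftrightarrow> True"
| "wf_nautilod (NInv p) \<longleftrightarrow> True"
| "wf_nautilod NAny \<longleftrightarrow> True"
| "wf_nautilod (NSeq ne1 ne2) \<longleftrightarrow> wf_nautilod ne1 \<and> wf_nautilod ne2"
| "wf_nautilod (NAlt ne1 ne2) \<longleftrightarrow> wf_nautilod ne1 \<and> wf_nautilod ne2"
| "wf_nautilod (NStar ne) \<longleftrightarrow> wf_nautilod ne"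
| "wf_nautilod (NAsk ne P) \<longleftrightarrow> wf_nautilod ne \<and> wf_pattern P"

definition ne_comp :: "('u, 'b, 'l, 'd) web \<Rightarrow> ('u \<Rightarrow> 'u set) \<Rightarrow> ('u \<Rightarrow> 'u set) \<Rightarrow>
    'u \<Rightarrow> 'u set" where
  "ne_comp W f g u = {u''. \<exists>u' \<in> f u. u' \<in> dom (adoc W) \<and> u'' \<in> g u'}"

text \<open>
  The semantics is meant for \<open>u \<in> dom (adoc W)\<close> only: elsewhere the value is irrelevant, and the
  equations below never consult it when started in \<open>dom (adoc W)\<close>.
\<close>

primrec eval_nautilod :: "('u, 'b, 'l, 'd) web \<Rightarrow> ('u, 'l, 'v) nautilod \<Rightarrow> 'u \<Rightarrow> 'u set" where
  "eval_nautilod W (NPred p) = (\<lambda>u. {u'. (URI u, URI p, URI u') \<in> doc_data W u})"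
| "eval_nautilod W (NInv p) = (\<lambda>u. {u'. (URI u', URI p, URI u) \<in> doc_data W u})"
| "eval_nautilod W NAny = (\<lambda>u. {u'. \<exists>p. (URI u, URI p, URI u') \<in> doc_data W u})"
| "eval_nautilod W (NSeq ne1 ne2) = ne_comp W (eval_nautilod W ne1) (eval_nautilod W ne2)"
| "eval_nautilod W (NAlt ne1 ne2) = (\<lambda>u. eval_nautilod W ne1 u \<union> eval_nautilod W ne2 u)"
| "eval_nautilod W (NStar ne) = (\<lambda>u. {u} \<union> (\<Union>n. powers (ne_comp W) (eval_nautilod W ne) n u))"
| "eval_nautilod W (NAsk ne P) = (\<lambda>u. {u' \<in> eval_nautilod W ne u. u' \<in> dom (adoc W) \<and>
     (eval_over_graph P (doc_data W u') :: ('u, 'b, 'l, 'v) mapping set) \<noteq> {}})"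

end

theory Submission
  imports Defs
begin

text \<open>
  NautiLOD expressions are translated by structural recursion into LDQL queries whose only answer
  variable is \<open>x\<close>. Three observations make this work.

  Evaluated from a single seed \<open>u\<close> in the domain of \<open>adoc\<close>, the pattern \<open>GRAPH ?y P\<close> over the
  path \<open>\<epsilon>\<close> binds \<open>?y\<close> to \<open>u\<close>, which lets a basic graph pattern refer to the context URI. Link
  patterns would not do for the atomic expressions, since they reach only URIs in the domain of
  \<open>adoc\<close>, whereas NautiLOD also returns the others.

  For the same reason the last step of a composition is taken by a query and not by a path: the
  intermediate URI \<open>?y\<close> is bound by a path, and \<open>SEED ?y q\<close> continues from it. Correspondingly,
  \<open>ne*\<close> is unfolded as \<open>\<epsilon> | ne*/ne\<close>.

  Finally, a NautiLOD test evaluates its pattern without named graphs, while an LDQL query always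
  sees some. Hence \<open>GRAPH\<close> is first eliminated from the pattern.
\<close>

section \<open>Elimination of \<open>GRAPH\<close> from patterns\<close>

text \<open>Unmatchable because no RDF triple has a literal as its subject; a contradictory filter would
  need a variable, which could be the target of an enclosing \<open>BIND\<close>.\<close>

definition unmatchable :: "('u, 'l, 'v) graph_pattern" where
  "unmatchable = BGP {|(Const (Inr undefined), Const undefined, Const (Inr undefined))|}"

text \<open>The flag tells whether the pattern is matched against the default graph or, below a \<open>GRAPH\<close>
  naming a nonexistent graph, against the empty one.\<close>

primrec elim_graph :: "('u, 'l, 'v) graph_pattern \<Rightarrow> bool \<Rightarrow> ('u, 'l, 'v) graph_pattern" where
  "elim_graph (BGP B) b = (if b \<or> B = {||} then BGP B else unmatchable)"
| "elim_graph (AND P1 P2) b = AND (elim_graph P1 b) (elim_graph P2 b)"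
| "elim_graph (UNION P1 P2) b = UNION (elim_graph P1 b) (elim_graph P2 b)"
| "elim_graph (OPT P1 P2) b = OPT (elim_graph P1 b) (elim_graph P2 b)"
| "elim_graph (FILTER P R) b = FILTER (elim_graph P b) R"
| "elim_graph (GRAPH c P) b = (case c of Const u \<Rightarrow> elim_graph P False | Var x \<Rightarrow> unmatchable)"
| "elim_graph (BIND P e v) b = BIND (elim_graph P b) e v"

lemma pattern_vars_unmatchable [simp]: "pattern_vars unmatchable = {}"
  by (simp add: unmatchable_def bgp_vars_def tp_vars_def)

lemma wf_unmatchable [simp]: "wf_pattern unmatchable"
  by (simp add: unmatchable_def)

lemma eval_unmatchable: "G \<subseteq> rdf_triples \<Longrightarrow> eval_pattern unmatchable \<DD> G = {}"
  by (auto simp: unmatchable_def eval_bgp_def subst_tp_def subst_def rdf_triples_def)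

text \<open>Serves the side condition on \<open>BIND\<close>: its target must stay fresh after the
  elimination. Equality fails, since the variables of replaced subpatterns disappear.\<close>

lemma pattern_vars_elim_graph: "pattern_vars (elim_graph P b) \<subseteq> pattern_vars P"
proof (induction P arbitrary: b)
  case (GRAPH c P)
  then show ?case by (cases c) auto
qed (auto simp: subset_iff)

lemma wf_elim_graph: "wf_pattern P \<Longrightarrow> wf_pattern (elim_graph P b)"
proof (induction P arbitrary: b)
  case (BIND P e v)
  then show ?case using pattern_vars_elim_graph[of P b] by auto
qed (simp_all split: slot.split)

lemma eval_bgp_empty [simp]: "eval_bgp {||} G = {Map.empty}"
  by (auto simp: eval_bgp_def bgp_vars_def)

lemma eval_bgp_empty_graph: "B \<noteq> {||} \<Longrightarrow> eval_bgp B {} = {}"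
  by (auto simp: eval_bgp_def)

text \<open>No \<open>GRAPH\<close> survives the elimination, so \<open>\<DD>\<close> is arbitrary
  on the left; on the right there are no named graphs, so a variable \<open>GRAPH\<close> yields
  nothing and a constant one moves to the empty graph. The left side stays on \<open>G\<close> even
  then: over the empty graph only the empty basic graph pattern has a solution, and that solution
  does not depend on the graph.\<close>

lemma eval_elim_graph:
  assumes "G \<subseteq> rdf_triples"
  shows "eval_pattern (elim_graph P b) \<DD> G =
    eval_pattern P \<lparr>default_graph = G', named_graphs = Map.empty\<rparr> (if b then G else {})"
  by (induction P arbitrary: b)
    (simp_all add: eval_unmatchable[OF assms] eval_bgp_empty_graph split: slot.split)

section \<open>Queries for atomic expressions, composition and tests\<close>

definition name_pattern :: "'v \<Rightarrow> ('u, 'l, 'v) graph_pattern" where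
  "name_pattern y = GRAPH (Var y) (BGP {||})"

definition atom_query :: "'v \<Rightarrow> 'v \<Rightarrow> ('u, 'l, 'v) triple_pattern \<Rightarrow> ('u, 'l, 'v) ldql" where
  "atom_query x y tp = Proj {|x|} (Basic Eps (GRAPH (Var y) (BGP {|tp|})))"

definition step_query :: "'v \<Rightarrow> 'v \<Rightarrow> ('u, 'l, 'v) lpe \<Rightarrow> ('u, 'l, 'v) ldql \<Rightarrow> ('u, 'l, 'v) ldql"
  where "step_query x y l q = Proj {|x|} (QAnd (Basic l (name_pattern y)) (SeedVar y q))"

text \<open>Projecting to no variables turns the solutions of the test into at most the empty
  mapping, so that variables of \<open>P\<close>, possibly \<open>x\<close> itself, cannot clash
  with the binding of \<open>x\<close>.\<close>

definition ask_query :: "'v \<Rightarrow> ('u, 'l, 'v) graph_pattern \<Rightarrow> ('u, 'l, 'v) ldql" where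
  "ask_query x P =
     QAnd (Basic Eps (name_pattern x)) (Proj {||} (Basic Eps (elim_graph P True)))"

lemma join_empty_map [simp]: "join {Map.empty} \<Omega> = \<Omega>" "join \<Omega> {Map.empty} = \<Omega>"
  by (simp_all add: join_def compatible_def)

lemma join_empty_set [simp]: "join \<Omega> {} = {}"
  by (simp add: join_def)

text \<open>The empty basic graph pattern contributes just the empty mapping, so what remains is the
  list of graph names: the URIs reached by the path that have a document.\<close>

lemma eval_name_pattern:
  "eval_ldql W (Basic l (name_pattern y)) S =
     {[y \<mapsto> URI u] | u. u \<in> dom (adoc W) \<and> (\<exists>s \<in> S. u \<in> eval_lpe W l s)}"
proof -
  have "dom (named_graphs (web_dataset W U)) = U \<inter> dom (adoc W)" for U
    by (auto simp: web_dataset_def split: if_splits)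
  then show ?thesis
    by (auto simp: name_pattern_def Let_def)
qed

lemma web_dataset_singleton:
  assumes "u \<in> dom (adoc W)"
  shows "default_graph (web_dataset W {u}) = doc_data W u"
    and "named_graphs (web_dataset W {u}) = [u \<mapsto> doc_data W u]"
  using assms by (auto simp: web_dataset_def)

lemma doc_data_rdf: "linked_data_web W \<Longrightarrow> doc_data W u \<subseteq> rdf_triples"
  by (auto simp: linked_data_web_def doc_data_def)

lemma restrict_singleton_eq_iff: "[x \<mapsto> t] = m |` {x} \<longleftrightarrow> m x = Some t"
  by (auto simp: restrict_map_def fun_eq_iff)

lemma dom_subset_singletonD: "dom m \<subseteq> {x} \<Longrightarrow> m x = Some t \<Longrightarrow> m = [x \<mapsto> t]"
  by (auto simp: fun_eq_iff dom_def)

lemma mem_eval_Proj_singleton: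
  "[x \<mapsto> t] \<in> eval_ldql W (Proj {|x|} q) S \<longleftrightarrow> (\<exists>m \<in> eval_ldql W q S. m x = Some t)"
  by (simp add: image_iff restrict_singleton_eq_iff)

lemma dom_eval_Proj_singleton: "m \<in> eval_ldql W (Proj {|x|} q) S \<Longrightarrow> dom m \<subseteq> {x}"
  by (auto split: if_splits simp: restrict_map_def)

text \<open>The reading of \<open>q(?x)\<close> in a fixed Web, here for all seed sets, finite or
  not.\<close>

definition dom_within :: "('u, 'b, 'l, 'd) web \<Rightarrow> ('u, 'l, 'v) ldql \<Rightarrow> 'v \<Rightarrow> bool" where
  "dom_within W q x \<longleftrightarrow> (\<forall>S. \<forall>m \<in> eval_ldql W q S. dom m \<subseteq> {x})"

text \<open>Since \<open>y\<close> occurs in \<open>tp\<close>, every match binds it; joining with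
  the graph name therefore acts as a selection and adds no binding.\<close>

lemma mem_eval_atom_query:
  fixes W :: "('u, 'b, 'l, 'd) web" and tp :: "('u, 'l, 'v) triple_pattern"
  assumes "u \<in> dom (adoc W)" "x \<noteq> y" "y \<in> tp_vars tp"
  shows "[x \<mapsto> t] \<in> eval_ldql W (atom_query x y tp) {u} \<longleftrightarrow>
    (\<exists>m \<in> eval_bgp {|tp|} (doc_data W u). m y = Some (URI u) \<and> m x = Some t)"
proof -
  have "join (eval_bgp {|tp|} G) {[y \<mapsto> URI u]} =
      {m \<in> eval_bgp {|tp|} G. m y = Some (URI u)}" for G :: "('u, 'b, 'l) triple set"
  proof -
    have "compatible m [y \<mapsto> URI u] \<longleftrightarrow> m y = Some (URI u)" if "m \<in> eval_bgp {|tp|} G"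
      for m :: "('u, 'b, 'l, 'v) mapping"
    proof -
      have "y \<in> dom m"
        using that assms(3) by (auto simp: eval_bgp_def bgp_vars_def)
      then show ?thesis
        by (auto simp: compatible_def)
    qed
    moreover have "m ++ [y \<mapsto> URI u] = m" if "m y = Some (URI u)"
      for m :: "('u, 'b, 'l, 'v) mapping"
      using that by (simp add: map_upd_triv)
    ultimately show ?thesis
      by (simp add: join_def set_eq_iff) metis
  qed
  then show ?thesis
    using assms(1)
    by (auto simp: atom_query_def mem_eval_Proj_singleton Let_def web_dataset_singleton
        simp del: eval_ldql.simps(6))
qed

text \<open>\<open>SeedVar\<close> tries every URI as a seed, and the join on \<open>y\<close>
  retains those named by the path. As \<open>q\<close> binds at most \<open>x\<close>, recording the
  seed in \<open>y\<close> cannot conflict with its answers.\<close>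

lemma mem_eval_step_query:
  assumes "x \<noteq> y" and "dom_within W q x"
  shows "[x \<mapsto> t] \<in> eval_ldql W (step_query x y l q) {u} \<longleftrightarrow>
    (\<exists>u' \<in> eval_lpe W l u. u' \<in> dom (adoc W) \<and> [x \<mapsto> t] \<in> eval_ldql W q {u'})"
    (is "?L \<longleftrightarrow> ?R")
proof
  assume ?L
  then have "\<exists>n \<in> eval_ldql W (QAnd (Basic l (name_pattern y)) (SeedVar y q)) {u}. n x = Some t"
    unfolding step_query_def mem_eval_Proj_singleton .
  then obtain n where n: "n \<in> eval_ldql W (QAnd (Basic l (name_pattern y)) (SeedVar y q)) {u}"
    and nx: "n x = Some t"
    by (rule bexE)
  obtain u1 u2 m where u1: "u1 \<in> dom (adoc W)" "u1 \<in> eval_lpe W l u"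
    and m: "m \<in> eval_ldql W q {u2}" and comp: "compatible [y \<mapsto> URI u1] (m ++ [y \<mapsto> URI u2])"
    and n_eq: "n = [y \<mapsto> URI u1] ++ (m ++ [y \<mapsto> URI u2])"
    using n unfolding eval_ldql.simps(3,4) eval_name_pattern join_def
    by (elim CollectE UN_E exE conjE bexE singletonE) simp
  have dom_m: "dom m \<subseteq> {x}"
    using assms(2) m unfolding dom_within_def by (elim allE ballE) auto
  \<comment> \<open>Both sides of the join bind \<open>y\<close>, one to the URI reached and one to
    the seed.\<close>
  have "u1 = u2"
    using comp by (auto simp: compatible_def)
  moreover have mx: "m x = Some t"
    using nx assms(1) by (simp add: n_eq map_add_def split: option.splits)
  moreover have "m = [x \<mapsto> t]"
    using dom_m mx by (rule dom_subset_singletonD)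
  ultimately show ?R
    using u1 m by auto
next
  assume ?R
  then obtain u' where u': "u' \<in> eval_lpe W l u" "u' \<in> dom (adoc W)"
    and q: "[x \<mapsto> t] \<in> eval_ldql W q {u'}"
    by blast
  let ?m = "[x \<mapsto> t, y \<mapsto> URI u']"
  have "?m \<in> eval_ldql W (SeedVar y q) S" for S
    using q assms(1) by (fastforce simp: join_def compatible_def)
  moreover have "[y \<mapsto> URI u'] \<in> eval_ldql W (Basic l (name_pattern y)) {u}"
    using u' by (auto simp: eval_name_pattern simp del: eval_ldql.simps)
  moreover have "compatible [y \<mapsto> URI u'] ?m"
    by (auto simp: compatible_def)
  ultimately have "[y \<mapsto> URI u'] ++ ?m \<in>
      eval_ldql W (QAnd (Basic l (name_pattern y)) (SeedVar y q)) {u}"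
    unfolding eval_ldql.simps(4) join_def by blast
  moreover have "([y \<mapsto> URI u'] ++ ?m) x = Some t"
    using assms(1) by simp
  ultimately show ?L
    unfolding step_query_def mem_eval_Proj_singleton
    by (rule bexI[where x = "[y \<mapsto> URI u'] ++ ?m", rotated])
qed

lemma eval_ask_query:
  fixes P :: "('u, 'l, 'v) graph_pattern" and W :: "('u, 'b, 'l, 'd) web"
  assumes "linked_data_web W" "u \<in> dom (adoc W)"
  shows "eval_ldql W (ask_query x P) {u} =
    (if (eval_over_graph P (doc_data W u) :: ('u, 'b, 'l, 'v) mapping set) = {} then {}
     else {[x \<mapsto> URI u]})"
proof -
  have "eval_ldql W (Basic Eps (elim_graph P True)) {u} = eval_over_graph P (doc_data W u)"
    using assms
    by (simp add: Let_def web_dataset_singleton doc_data_rdf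
        eval_elim_graph[where b = True and G' = "doc_data W u"] eval_over_graph_def)
  moreover have "eval_ldql W (Basic Eps (name_pattern x)) {u} = {[x \<mapsto> URI u]}"
    using assms(2) by (auto simp: eval_name_pattern simp del: eval_ldql.simps)
  ultimately show ?thesis
    by (simp add: ask_query_def image_constant_conv del: eval_ldql.simps(1))
qed

lemma dom_within_ask_query: "dom_within W (ask_query x P) x"
  by (auto simp: dom_within_def ask_query_def eval_name_pattern join_def simp del: eval_ldql.simps(1)
      split: if_splits)

section \<open>The translation and its correctness\<close>

primrec to_ldql :: "'v \<Rightarrow> 'v \<Rightarrow> 'v \<Rightarrow> ('u, 'l, 'v) nautilod \<Rightarrow> ('u, 'l, 'v) ldql" where
  "to_ldql x y z (NPred p) = atom_query x y (Var y, Const p, Var x)"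
| "to_ldql x y z (NInv p) = atom_query x y (Var x, Const p, Var y)"
| "to_ldql x y z NAny = atom_query x y (Var y, Var z, Var x)"
| "to_ldql x y z (NSeq ne1 ne2) =
     step_query x y (SubQuery x (to_ldql x y z ne1)) (to_ldql x y z ne2)"
| "to_ldql x y z (NAlt ne1 ne2) = QUnion (to_ldql x y z ne1) (to_ldql x y z ne2)"
| "to_ldql x y z (NStar ne) = QUnion (Basic Eps (name_pattern x))
     (step_query x y (Star (SubQuery x (to_ldql x y z ne))) (to_ldql x y z ne))"
| "to_ldql x y z (NAsk ne P) =
     step_query x y (SubQuery x (to_ldql x y z ne)) (ask_query x P)"

lemma wf_to_ldql: "wf_nautilod ne \<Longrightarrow> wf_ldql (to_ldql x y z ne)"
  by (induction ne)
    (auto simp: atom_query_def step_query_def ask_query_def name_pattern_def wf_elim_graph)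

text \<open>Apart from unions and \<open>name_pattern x\<close>, every construct ends in an answer
  restricted to \<open>x\<close>. Hence nested queries never export \<open>y\<close> or
  \<open>z\<close>, and the same three variables can be reused at all levels.\<close>

lemma dom_eval_to_ldql: "m \<in> eval_ldql W (to_ldql x y z ne) S \<Longrightarrow> dom m \<subseteq> {x}"
proof (induction ne arbitrary: m S)
  case (NStar ne)
  then show ?case
    using dom_eval_Proj_singleton[of m W x]
    by (auto simp: step_query_def eval_name_pattern simp del: eval_ldql.simps(1,6)
        split: if_splits)
next
  case (NAlt ne1 ne2)
  then show ?case
    unfolding to_ldql.simps eval_ldql.simps by (elim UnE) auto
qed (auto simp: atom_query_def step_query_def restrict_map_def split: if_splits)

lemma dom_within_to_ldql: "dom_within W (to_ldql x y z ne) x"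
  unfolding dom_within_def by (intro allI ballI dom_eval_to_ldql)

text \<open>The domain guard in \<open>ne_comp\<close> is automatic for paths, which are empty
  outside the domain of \<open>adoc\<close>; the values of \<open>f\<close> there are never
  consulted.\<close>

lemma powers_lpe_comp_eq_powers_ne_comp:
  assumes "u \<in> dom (adoc W)" "\<And>v. v \<in> dom (adoc W) \<Longrightarrow> g v = f v"
    and "\<And>v. v \<notin> dom (adoc W) \<Longrightarrow> g v = {}"
  shows "powers lpe_comp g n u = powers (ne_comp W) f n u"
proof (induction n)
  case (Suc n)
  have "(\<Union>u' \<in> A. g u') = {u''. \<exists>u' \<in> A. u' \<in> dom (adoc W) \<and> u'' \<in> f u'}" for A
    using assms(2,3) by blast
  with Suc show ?case
    by (simp add: lpe_comp_def ne_comp_def)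
qed (simp add: assms(1,2))

lemma mem_eval_SubQuery_single:
  assumes "dom_within W q x"
  shows "u' \<in> eval_lpe W (SubQuery x q) u \<longleftrightarrow>
    u \<in> dom (adoc W) \<and> [x \<mapsto> URI u'] \<in> eval_ldql W q {u}"
proof -
  have "m = [x \<mapsto> t]" if "m \<in> eval_ldql W q {u}" "m x = Some t" for m t
  proof -
    have "dom m \<subseteq> {x}"
      using assms that(1) unfolding dom_within_def by (elim allE ballE) auto
    then show ?thesis
      using that(2) by (rule dom_subset_singletonD)
  qed
  then have "(\<exists>m \<in> eval_ldql W q {u}. m x = Some (URI u')) \<longleftrightarrow> [x \<mapsto> URI u'] \<in> eval_ldql W q {u}"
    by (metis fun_upd_same)
  then show ?thesis
    by simp
qed

lemma eval_SubQuery_eq: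
  assumes "dom_within W q x" "u \<in> dom (adoc W)"
    and "\<And>u'. u' \<in> A \<longleftrightarrow> [x \<mapsto> URI u'] \<in> eval_ldql W q {u}"
  shows "eval_lpe W (SubQuery x q) u = A"
  unfolding set_eq_iff mem_eval_SubQuery_single[OF assms(1)] using assms(2,3) by simp

text \<open>Splits off the last step of an iteration. Index 0 already stands for one step and
  corresponds to \<open>u' = u\<close>, which passes the guard because \<open>u\<close> has a
  document.\<close>

lemma union_powers_unfold:
  assumes "u \<in> dom (adoc W)"
  shows "(\<Union>n. powers (ne_comp W) f n u) =
     {u''. \<exists>u' \<in> {u} \<union> (\<Union>n. powers (ne_comp W) f n u). u' \<in> dom (adoc W) \<and> u'' \<in> f u'}"
proof -
  have nat: "(UNIV :: nat set) = insert 0 (range Suc)"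
    using not0_implies_Suc by blast
  have "(\<Union>n. powers (ne_comp W) f n u) =
      powers (ne_comp W) f 0 u \<union> (\<Union>n. powers (ne_comp W) f (Suc n) u)"
    by (subst nat) simp
  also have "\<dots> = {u''. \<exists>u' \<in> {u} \<union> (\<Union>n. powers (ne_comp W) f n u).
      u' \<in> dom (adoc W) \<and> u'' \<in> f u'}"
    using assms by (auto simp: ne_comp_def)
  finally show ?thesis .
qed

lemma eval_nautilod_eq_to_ldql:
  fixes ne :: "('u, 'l, 'v) nautilod" and W :: "('u, 'b, 'l, 'd) web"
  assumes xy: "x \<noteq> y" and z: "z \<notin> {x, y}" and W: "linked_data_web W" and "u \<in> dom (adoc W)"
  shows "u' \<in> eval_nautilod W ne u \<longleftrightarrow> [x \<mapsto> URI u'] \<in> eval_ldql W (to_ldql x y z ne) {u}"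
  using assms(4)
proof (induction ne arbitrary: u u')
  case (NPred p)
  let ?tp = "(Var y, Const p, Var x) :: ('u, 'l, 'v) triple_pattern"
  have "(\<exists>m \<in> eval_bgp {|?tp|} (doc_data W u). m y = Some (URI u) \<and> m x = Some (URI u'))
      \<longleftrightarrow> (URI u, URI p, URI u') \<in> doc_data W u" (is "?L \<longleftrightarrow> ?R")
  proof
    show ?R if ?L
      using that by (auto simp: eval_bgp_def subst_tp_def subst_def)
    show ?L if ?R
    proof (rule bexI)
      show "[x \<mapsto> URI u', y \<mapsto> URI u] \<in> eval_bgp {|?tp|} (doc_data W u)"
        using that xy by (force simp: eval_bgp_def bgp_vars_def tp_vars_def subst_tp_def subst_def)
    qed (use xy in simp)
  qed
  moreover have "y \<in> tp_vars ?tp"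
    by (simp add: tp_vars_def)
  ultimately show ?case
    by (simp only: to_ldql.simps mem_eval_atom_query[OF NPred xy] eval_nautilod.simps
        mem_Collect_eq)
next
  case (NInv p)
  let ?tp = "(Var x, Const p, Var y) :: ('u, 'l, 'v) triple_pattern"
  have "(\<exists>m \<in> eval_bgp {|?tp|} (doc_data W u). m y = Some (URI u) \<and> m x = Some (URI u'))
      \<longleftrightarrow> (URI u', URI p, URI u) \<in> doc_data W u" (is "?L \<longleftrightarrow> ?R")
  proof
    show ?R if ?L
      using that by (auto simp: eval_bgp_def subst_tp_def subst_def)
    show ?L if ?R
    proof (rule bexI)
      show "[x \<mapsto> URI u', y \<mapsto> URI u] \<in> eval_bgp {|?tp|} (doc_data W u)"
        using that xy by (force simp: eval_bgp_def bgp_vars_def tp_vars_def subst_tp_def subst_def)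
    qed (use xy in simp)
  qed
  moreover have "y \<in> tp_vars ?tp"
    by (simp add: tp_vars_def)
  ultimately show ?case
    by (simp only: to_ldql.simps mem_eval_atom_query[OF NInv xy] eval_nautilod.simps mem_Collect_eq)
next
  case NAny
  let ?tp = "(Var y, Var z, Var x) :: ('u, 'l, 'v) triple_pattern"
  have "(\<exists>m \<in> eval_bgp {|?tp|} (doc_data W u). m y = Some (URI u) \<and> m x = Some (URI u'))
      \<longleftrightarrow> (\<exists>p. (URI u, URI p, URI u') \<in> doc_data W u)" (is "?L \<longleftrightarrow> ?R")
  proof
    assume ?L
    then obtain m :: "('u, 'b, 'l, 'v) mapping" where
      m: "m \<in> eval_bgp {|?tp|} (doc_data W u)" "m y = Some (URI u)" "m x = Some (URI u')"
      by auto
    have "z \<in> dom m"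
      using m(1) by (simp add: eval_bgp_def bgp_vars_def tp_vars_def)
    then obtain t where "m z = Some t"
      by auto
    then have "(URI u, t, URI u') \<in> doc_data W u"
      using m by (auto simp: eval_bgp_def subst_tp_def subst_def)
    \<comment> \<open>\<open>z\<close> may be bound to any term, whereas \<open>NAny\<close> asks
      for a URI; the shape of RDF triples closes this gap.\<close>
    moreover from this have "t \<in> range URI"
      using doc_data_rdf[OF W] by (auto simp: rdf_triples_def)
    ultimately show ?R
      by auto
  next
    assume ?R
    then obtain p where p: "(URI u, URI p, URI u') \<in> doc_data W u"
      by auto
    show ?L
    proof (rule bexI)
      show "[x \<mapsto> URI u', y \<mapsto> URI u, z \<mapsto> URI p]
          \<in> eval_bgp {|?tp|} (doc_data W u)"
        using p xy z by (force simp: eval_bgp_def bgp_vars_def tp_vars_def subst_tp_def subst_def)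
    qed (use xy z in auto)
  qed
  moreover have "y \<in> tp_vars ?tp"
    by (simp add: tp_vars_def)
  ultimately show ?case
    by (simp only: to_ldql.simps mem_eval_atom_query[OF NAny xy] eval_nautilod.simps mem_Collect_eq)
next
  case (NSeq ne1 ne2)
  have "eval_lpe W (SubQuery x (to_ldql x y z ne1)) u = eval_nautilod W ne1 u"
    using dom_within_to_ldql NSeq.prems NSeq.IH(1)[OF NSeq.prems] by (rule eval_SubQuery_eq)
  then have "[x \<mapsto> URI u'] \<in> eval_ldql W (to_ldql x y z (NSeq ne1 ne2)) {u} \<longleftrightarrow>
      (\<exists>v \<in> eval_nautilod W ne1 u. v \<in> dom (adoc W) \<and>
        [x \<mapsto> URI u'] \<in> eval_ldql W (to_ldql x y z ne2) {v})"
    by (simp only: to_ldql.simps mem_eval_step_query[OF xy dom_within_to_ldql])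
  \<comment> \<open>The guard of \<open>ne_comp\<close>, made available by \<open>conj_cong\<close>,
    is the premise of the induction hypothesis at the new start \<open>v\<close>.\<close>
  also have "\<dots> \<longleftrightarrow> (\<exists>v \<in> eval_nautilod W ne1 u. v \<in> dom (adoc W) \<and> u' \<in> eval_nautilod W ne2 v)"
    by (intro bex_cong conj_cong refl NSeq.IH(2)[symmetric])
  finally show ?case
    by (simp only: eval_nautilod.simps ne_comp_def mem_Collect_eq)
next
  case (NAlt ne1 ne2)
  then show ?case by simp
next
  case (NStar ne)
  let ?f = "eval_nautilod W ne"
  let ?q = "to_ldql x y z ne"
  have step: "eval_lpe W (SubQuery x ?q) v = ?f v" if "v \<in> dom (adoc W)" for v
    using dom_within_to_ldql that NStar.IH[OF that] by (rule eval_SubQuery_eq)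
  have "powers lpe_comp (eval_lpe W (SubQuery x ?q)) n u = powers (ne_comp W) ?f n u" for n
    using powers_lpe_comp_eq_powers_ne_comp[OF NStar.prems step] by auto
  then have star: "eval_lpe W (Star (SubQuery x ?q)) u =
      {u} \<union> (\<Union>n. powers (ne_comp W) ?f n u)"
    using NStar.prems by (simp del: eval_lpe.simps(7))
  have "[x \<mapsto> URI u'] \<in> eval_ldql W (step_query x y (Star (SubQuery x ?q)) ?q) {u} \<longleftrightarrow>
      (\<exists>v \<in> {u} \<union> (\<Union>n. powers (ne_comp W) ?f n u). v \<in> dom (adoc W) \<and>
        [x \<mapsto> URI u'] \<in> eval_ldql W ?q {v})"
    by (simp only: mem_eval_step_query[OF xy dom_within_to_ldql] star)
  also have "\<dots> \<longleftrightarrow>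
      (\<exists>v \<in> {u} \<union> (\<Union>n. powers (ne_comp W) ?f n u). v \<in> dom (adoc W) \<and> u' \<in> ?f v)"
    by (intro bex_cong conj_cong refl NStar.IH[symmetric])
  \<comment> \<open>Only the union on the right is unfolded; both sides then coincide.\<close>
  also have "\<dots> \<longleftrightarrow> u' \<in> (\<Union>n. powers (ne_comp W) ?f n u)"
    by (subst (2) union_powers_unfold[OF NStar.prems]) (simp only: mem_Collect_eq)
  finally have "[x \<mapsto> URI u'] \<in> eval_ldql W (step_query x y (Star (SubQuery x ?q)) ?q) {u} \<longleftrightarrow>
      u' \<in> (\<Union>n. powers (ne_comp W) ?f n u)" .
  moreover have "[x \<mapsto> URI u'] \<in> eval_ldql W (Basic Eps (name_pattern x)) {u} \<longleftrightarrow> u' = u"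
    using NStar.prems by (auto simp: eval_name_pattern fun_eq_iff simp del: eval_ldql.simps)
  ultimately show ?case
    by (simp only: to_ldql.simps eval_ldql.simps(5) eval_nautilod.simps Un_iff singleton_iff)
next
  case (NAsk ne P)
  let ?sat = "(eval_over_graph P (doc_data W u') :: ('u, 'b, 'l, 'v) mapping set) \<noteq> {}"
  have ask: "[x \<mapsto> URI u'] \<in> eval_ldql W (ask_query x P) {v} \<longleftrightarrow> v = u' \<and> ?sat"
    if "v \<in> dom (adoc W)" for v
    by (auto simp: eval_ask_query[OF W that] fun_eq_iff)
  have "eval_lpe W (SubQuery x (to_ldql x y z ne)) u = eval_nautilod W ne u"
    using dom_within_to_ldql NAsk.prems NAsk.IH[OF NAsk.prems] by (rule eval_SubQuery_eq)
  then have "[x \<mapsto> URI u'] \<in> eval_ldql W (to_ldql x y z (NAsk ne P)) {u} \<longleftrightarrow>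
      (\<exists>v \<in> eval_nautilod W ne u. v \<in> dom (adoc W) \<and>
        [x \<mapsto> URI u'] \<in> eval_ldql W (ask_query x P) {v})"
    by (simp only: to_ldql.simps mem_eval_step_query[OF xy dom_within_ask_query])
  also have "\<dots> \<longleftrightarrow> (\<exists>v \<in> eval_nautilod W ne u. v \<in> dom (adoc W) \<and> v = u' \<and> ?sat)"
    by (intro bex_cong conj_cong refl ask)
  finally show ?case
    by (simp only: eval_nautilod.simps mem_Collect_eq) blast
qed

theorem theorem3:
  fixes ne :: "('u::infinite, 'l::infinite, 'v::infinite) nautilod"
  assumes "wf_nautilod ne"
  shows "\<exists>(q :: ('u, 'l, 'v) ldql) (x :: 'v). wf_ldql q \<and>
    (\<forall>(W :: ('u, 'b::infinite, 'l, 'd::infinite) web) S \<mu>.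
       linked_data_web W \<longrightarrow> finite S \<longrightarrow> \<mu> \<in> eval_ldql W q S \<longrightarrow> dom \<mu> \<subseteq> {x}) \<and>
    (\<forall>(W :: ('u, 'b, 'l, 'd) web) u u'.
       linked_data_web W \<longrightarrow> u \<in> dom (adoc W) \<longrightarrow>
       (u' \<in> eval_nautilod W ne u \<longleftrightarrow> [x \<mapsto> URI u'] \<in> eval_ldql W q {u}))"
proof -
  \<comment> \<open>Any variable can serve as \<open>x\<close>; infinity of the type of variables
    supplies two further ones.\<close>
  obtain x :: 'v where True
    by blast
  obtain y :: 'v where xy: "x \<noteq> y"
    using ex_new_if_finite[OF infinite_UNIV, of "{x}"] by (metis finite.intros singletonI)
  obtain z :: 'v where z: "z \<notin> {x, y}"
    using ex_new_if_finite[OF infinite_UNIV, of "{x, y}"] by auto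
  show ?thesis
  proof (intro exI conjI allI impI)
    show "wf_ldql (to_ldql x y z ne)"
      using assms by (rule wf_to_ldql)
  next
    fix W :: "('u, 'b, 'l, 'd) web" and S \<mu>
    assume "\<mu> \<in> eval_ldql W (to_ldql x y z ne) S"
    then show "dom \<mu> \<subseteq> {x}"
      by (rule dom_eval_to_ldql)
  next
    fix W :: "('u, 'b, 'l, 'd) web" and u u'
    assume "linked_data_web W" "u \<in> dom (adoc W)"
    then show "u' \<in> eval_nautilod W ne u \<longleftrightarrow>
        [x \<mapsto> URI u'] \<in> eval_ldql W (to_ldql x y z ne) {u}"
      by (rule eval_nautilod_eq_to_ldql[OF xy z])
  qed
qed

end
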